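(* Let $d\in\mathbb{N}$, let $O\subset\mathbb{R}^d$ be a non-empty open set, let $S\subset O$ be a Borel set whose closure is a compact subset of $O$, and let $\omega\in\mathrm{Meas}^+_{\mathrm{cmp}}(O)$ satisfy $\operatorname{supp}\omega\subset S$. (1) Let $\varTheta\colon S\to\mathrm{Meas}^+_{\mathrm{cmp}}(O)$, $\vartheta_x:=\varTheta(x)$, be such that the closure of $\bigcup_{x\in S}\operatorname{supp}\vartheta_x$ is a compact subset of $O$, $\sup_{x\in S}\vartheta_x(O)<+\infty$, and for each $f\in C_0(O)$ the function $x\mapsto\int_O f\,d\vartheta_x$ is Borel measurable on $S$. Let $\varnothing\ne H\subset\mathrm{usc}(O)$. If for every $x\in S$ the measure $\vartheta_x$ is an $H$-balayage of the Dirac measure $\delta_x$ at $x$, then the measure $\int\varTheta\,d\omega\in\mathrm{Meas}^+_{\mathrm{cmp}}(O)$ is an $H$-balayage of $\omega$. (2) Let $r>0$ be such that the closure of $\bigcup_{x\in S}B(x,r)$ is a compact subset of $O$, and let $\vartheta\in\mathrm{Meas}^+_{\mathrm{cmp}}(B(0,r))$. If $\vartheta$ is an Arens–Singer measure on $B(0,r)$ at $0$, then the convolution $\omega*\vartheta\in\mathrm{Meas}^+_{\mathrm{cmp}}(O)$ is a $\mathrm{har}(O)$-balayage of $\omega$. If $\vartheta$ is a Jensen measure on $B(0,r)$ at $0$, then $\omega*\vartheta$ is a $\mathrm{sbh}(O)$-balayage of $\omega$.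
   Context: For an open set $O\subset\mathbb{R}^d$: $\mathrm{Meas}^+_{\mathrm{cmp}}(O)$ is the set of positive Borel (Radon) measures on $O$ with compact support in $O$; $C_0(O)$ is the space of continuous real functions on $O$ with compact support in $O$; $\mathrm{usc}(O)$ is the set of upper semicontinuous functions $O\to\mathbb{R}\cup\{-\infty\}$; $\mathrm{har}(O)$ and $\mathrm{sbh}(O)$ are the classes of harmonic and subharmonic functions on $O$ (the function identically $-\infty$ on a component counts as subharmonic). $B(x,r)$ is the open Euclidean ball of radius $r$ centered at $x$. Balayage: for $H\subset\mathrm{usc}(O)$ and $\delta,\omega\in\mathrm{Meas}^+_{\mathrm{cmp}}(O)$, $\omega$ is an $H$-balayage of $\delta$ (written $\delta\preceq_H\omega$) if $\int h\,d\delta\le\int h\,d\omega$ for every $h\in H$ (integrals with values in $\mathbb{R}\cup\{-\infty\}$). For $x\in O$, a measure $\mu\in\mathrm{Meas}^+_{\mathrm{cmp}}(O)$ is a Jensen measure on $O$ at $x$ if it is a $\mathrm{sbh}(O)$-balayage of $\delta_x$, and an Arens–Singer measure on $O$ at $x$ if it is a $\mathrm{har}(O)$-balayage of $\delta_x$. Integral of measures: $\int\varTheta\,d\omega$ is the positive Borel measure on $O$ given by $\bigl(\int\varTheta\,d\omega\bigr)(B)=\int_S\vartheta_x(B)\,d\omega(x)$ for Borel $B$ with compact closure in $O$; equivalently, it acts by $f\mapsto\int_S\bigl(\int f\,d\vartheta_x\bigr)d\omega(x)$ for $f\in\mathrm{usc}(O)$. Convolution: $\omega*\vartheta$ is the positive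 Borel measure on $O$ given by $(\omega*\vartheta)(B)=\int_S\vartheta(B-x)\,d\omega(x)$; equivalently, $\int f\,d(\omega*\vartheta)=\int_S\bigl(\int_{B(0,r)}f(x+y)\,d\vartheta(y)\bigr)d\omega(x)$ for $f\in\mathrm{usc}(O)$. *)

theory Defs
  imports "HOL-Probability.Giry_Monad"
begin

section \<open>Measures with compact support\<close>

definition measure_support :: "'a::topological_space measure \<Rightarrow> 'a set" where
  "measure_support \<mu> =
     {x \<in> space \<mu>. \<forall>V. open V \<longrightarrow> x \<in> V \<longrightarrow> emeasure \<mu> (V \<inter> space \<mu>) > 0}"

text \<open>
  A measure on \<open>U\<close> has \<open>U\<close> itself as its space. A Borel measure on an open subset of a Euclidean
  space that is finite on compact sets is automatically regular, so no regularity is required.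
\<close>

definition Meas_cmp :: "'a::topological_space set \<Rightarrow> 'a measure set" where
  "Meas_cmp U = {\<mu>. sets \<mu> = sets (restrict_space borel U) \<and>
                    (\<forall>K. compact K \<longrightarrow> K \<subseteq> U \<longrightarrow> emeasure \<mu> K < \<infinity>) \<and>
                    compact (measure_support \<mu>)}"

definition dirac :: "'a::topological_space set \<Rightarrow> 'a \<Rightarrow> 'a measure" where
  "dirac U x = return (restrict_space borel U) x"


section \<open>Function classes\<close>

text \<open>
  Functions on \<open>U\<close> are total functions of which only the values on \<open>U\<close> matter.
\<close>

definition C0 :: "'a::topological_space set \<Rightarrow> ('a \<Rightarrow> real) set" where
  "C0 U = {f. continuous_on U f \<and>
              compact (closure {x \<in> U. f x \<noteq> 0}) \<and> closure {x \<in> U. f x \<noteq> 0} \<subseteq> U}"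

definition usc :: "'a::topological_space set \<Rightarrow> ('a \<Rightarrow> ereal) set" where
  "usc U = {f. (\<forall>x\<in>U. f x < \<infinity>) \<and> (\<forall>c. openin (top_of_set U) {x \<in> U. f x < c})}"

text \<open>
  A harmonic function is twice continuously (Frechet) differentiable with vanishing Laplacian, the
  Laplacian being the trace of the second derivative.
\<close>

definition harmonic_on :: "('a::euclidean_space \<Rightarrow> real) \<Rightarrow> 'a set \<Rightarrow> bool" where
  "harmonic_on u U \<longleftrightarrow>
     (\<exists>(u' :: 'a \<Rightarrow> 'a \<Rightarrow>\<^sub>L real) (u'' :: 'a \<Rightarrow> 'a \<Rightarrow>\<^sub>L 'a \<Rightarrow>\<^sub>L real).
        (\<forall>x\<in>U. (u has_derivative blinfun_apply (u' x)) (at x)) \<and>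
        (\<forall>x\<in>U. (u' has_derivative blinfun_apply (u'' x)) (at x)) \<and>
        continuous_on U u'' \<and>
        (\<forall>x\<in>U. (\<Sum>b\<in>Basis. blinfun_apply (blinfun_apply (u'' x) b) b) = 0))"

definition har :: "'a::euclidean_space set \<Rightarrow> ('a \<Rightarrow> ereal) set" where
  "har U = {h. \<exists>u. harmonic_on u U \<and> (\<forall>x\<in>U. h x = ereal (u x))}"

text \<open>
  Subharmonicity by comparison with harmonic functions on closed balls; it admits functions that
  are identically \<open>-\<infinity>\<close> on components of \<open>U\<close>.
\<close>

definition sbh :: "'a::euclidean_space set \<Rightarrow> ('a \<Rightarrow> ereal) set" where
  "sbh U = {f \<in> usc U. \<forall>x r u. r > 0 \<longrightarrow> cball x r \<subseteq> U \<longrightarrow>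
              continuous_on (cball x r) u \<longrightarrow> harmonic_on u (ball x r) \<longrightarrow>
              (\<forall>y\<in>sphere x r. f y \<le> ereal (u y)) \<longrightarrow> (\<forall>y\<in>ball x r. f y \<le> ereal (u y))}"


section \<open>Balayage\<close>

text \<open>
  The integral of an extended real function as the difference of the integrals of its positive and
  negative parts. An upper semicontinuous function is bounded above on the compact support of a
  measure in \<^const>\<open>Meas_cmp\<close>, so the minuend is finite there and the value lies below \<open>\<infinity>\<close>.
\<close>

definition ereal_integral :: "'a measure \<Rightarrow> ('a \<Rightarrow> ereal) \<Rightarrow> ereal" where
  "ereal_integral \<mu> f =
     enn2ereal (\<integral>\<^sup>+x. e2ennreal (f x) \<partial>\<mu>) - enn2ereal (\<integral>\<^sup>+x. e2ennreal (- f x) \<partial>\<mu>)"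

text \<open>\<open>balayage H \<delta> \<mu>\<close>: the measure \<open>\<mu>\<close> is an \<open>H\<close>-balayage of \<open>\<delta>\<close>.\<close>

definition balayage :: "('a \<Rightarrow> ereal) set \<Rightarrow> 'a measure \<Rightarrow> 'a measure \<Rightarrow> bool" where
  "balayage H \<delta> \<mu> \<longleftrightarrow> (\<forall>h\<in>H. ereal_integral \<delta> h \<le> ereal_integral \<mu> h)"

definition Jensen_measure :: "'a::euclidean_space set \<Rightarrow> 'a \<Rightarrow> 'a measure \<Rightarrow> bool" where
  "Jensen_measure U x \<mu> \<longleftrightarrow> x \<in> U \<and> \<mu> \<in> Meas_cmp U \<and> balayage (sbh U) (dirac U x) \<mu>"

definition Arens_Singer_measure :: "'a::euclidean_space set \<Rightarrow> 'a \<Rightarrow> 'a measure \<Rightarrow> bool" where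
  "Arens_Singer_measure U x \<mu> \<longleftrightarrow> x \<in> U \<and> \<mu> \<in> Meas_cmp U \<and> balayage (har U) (dirac U x) \<mu>"


section \<open>Integrals of measures and convolution\<close>

definition integral_of_measures ::
    "'a set \<Rightarrow> ('a \<Rightarrow> 'a measure) \<Rightarrow> 'a measure \<Rightarrow> 'a measure" where
  "integral_of_measures S \<theta> \<mu> =
     measure_of (space \<mu>) (sets \<mu>) (\<lambda>B. \<integral>\<^sup>+x\<in>S. emeasure (\<theta> x) B \<partial>\<mu>)"

text \<open>
  The set below is \<open>B - x\<close> intersected with the space of \<open>\<theta>\<close>: the measure \<open>\<theta>\<close> lives on a ball
  around the origin and is extended by zero, while \<open>B - x\<close> need not lie in that ball.
\<close>

definition convolve_measures ::
    "'a::plus set \<Rightarrow> 'a measure \<Rightarrow> 'a measure \<Rightarrow> 'a measure" where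
  "convolve_measures S \<mu> \<theta> =
     measure_of (space \<mu>) (sets \<mu>)
       (\<lambda>B. \<integral>\<^sup>+x\<in>S. emeasure \<theta> {y \<in> space \<theta>. x + y \<in> B} \<partial>\<mu>)"

text \<open>
  Both set functions are measures once their integrands are measurable, so that \<^const>\<open>measure_of\<close>
  does not fall back to the zero measure.
\<close>

lemma emeasure_integral_of_measures:
  assumes "\<And>x. x \<in> S \<Longrightarrow> sets (\<theta> x) = sets \<mu>"
    and "\<And>B. B \<in> sets \<mu> \<Longrightarrow> (\<lambda>x. emeasure (\<theta> x) B * indicator S x) \<in> borel_measurable \<mu>"
    and "B \<in> sets \<mu>"
  shows "emeasure (integral_of_measures S \<theta> \<mu>) B = (\<integral>\<^sup>+x\<in>S. emeasure (\<theta> x) B \<partial>\<mu>)"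
proof (rule emeasure_measure_of[OF integral_of_measures_def])
  show "countably_additive (sets (integral_of_measures S \<theta> \<mu>))
          (\<lambda>B. \<integral>\<^sup>+x\<in>S. emeasure (\<theta> x) B \<partial>\<mu>)"
  proof (rule countably_additiveI)
    fix A :: "nat \<Rightarrow> 'a set"
    assume "range A \<subseteq> sets (integral_of_measures S \<theta> \<mu>)" and disj: "disjoint_family A"
    then have A: "range A \<subseteq> sets \<mu>"
      by (simp add: integral_of_measures_def)
    have "(\<Sum>i. \<integral>\<^sup>+x\<in>S. emeasure (\<theta> x) (A i) \<partial>\<mu>)
            = (\<integral>\<^sup>+x. (\<Sum>i. emeasure (\<theta> x) (A i) * indicator S x) \<partial>\<mu>)"
      using A assms(2) by (intro nn_integral_suminf[symmetric]) auto
    also have "\<dots> = (\<integral>\<^sup>+x\<in>S. emeasure (\<theta> x) (\<Union>i. A i) \<partial>\<mu>)"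
      using A disj assms(1)
      by (intro nn_integral_cong) (auto simp: suminf_emeasure split: split_indicator)
    finally show "(\<Sum>i. \<integral>\<^sup>+x\<in>S. emeasure (\<theta> x) (A i) \<partial>\<mu>)
        = (\<integral>\<^sup>+x\<in>S. emeasure (\<theta> x) (\<Union>i. A i) \<partial>\<mu>)" .
  qed
qed (use assms(3) sets.space_closed in \<open>auto simp: integral_of_measures_def positive_def\<close>)

lemma emeasure_convolve_measures:
  assumes "\<And>x B. x \<in> S \<Longrightarrow> B \<in> sets \<mu> \<Longrightarrow> {y \<in> space \<theta>. x + y \<in> B} \<in> sets \<theta>"
    and "\<And>B. B \<in> sets \<mu> \<Longrightarrow>
          (\<lambda>x. emeasure \<theta> {y \<in> space \<theta>. x + y \<in> B} * indicator S x) \<in> borel_measurable \<mu>"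
    and "B \<in> sets \<mu>"
  shows "emeasure (convolve_measures S \<mu> \<theta>) B
           = (\<integral>\<^sup>+x\<in>S. emeasure \<theta> {y \<in> space \<theta>. x + y \<in> B} \<partial>\<mu>)"
proof (rule emeasure_measure_of[OF convolve_measures_def])
  show "countably_additive (sets (convolve_measures S \<mu> \<theta>))
          (\<lambda>B. \<integral>\<^sup>+x\<in>S. emeasure \<theta> {y \<in> space \<theta>. x + y \<in> B} \<partial>\<mu>)"
  proof (rule countably_additiveI)
    fix A :: "nat \<Rightarrow> 'a set"
    assume "range A \<subseteq> sets (convolve_measures S \<mu> \<theta>)" and disj: "disjoint_family A"
    then have A: "range A \<subseteq> sets \<mu>"
      by (simp add: convolve_measures_def)
    have union: "(\<Sum>i. emeasure \<theta> {y \<in> space \<theta>. x + y \<in> A i})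
        = emeasure \<theta> {y \<in> space \<theta>. x + y \<in> (\<Union>i. A i)}" if "x \<in> S" for x
    proof -
      have "(\<Sum>i. emeasure \<theta> {y \<in> space \<theta>. x + y \<in> A i})
          = emeasure \<theta> (\<Union>i. {y \<in> space \<theta>. x + y \<in> A i})"
        using A disj assms(1)[OF that]
        by (intro suminf_emeasure) (auto simp: disjoint_family_on_def)
      also have "(\<Union>i. {y \<in> space \<theta>. x + y \<in> A i}) = {y \<in> space \<theta>. x + y \<in> (\<Union>i. A i)}"
        by auto
      finally show ?thesis .
    qed
    have "(\<Sum>i. \<integral>\<^sup>+x\<in>S. emeasure \<theta> {y \<in> space \<theta>. x + y \<in> A i} \<partial>\<mu>)
            = (\<integral>\<^sup>+x. (\<Sum>i. emeasure \<theta> {y \<in> space \<theta>. x + y \<in> A i} * indicator S x) \<partial>\<mu>)"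
      using A assms(2) by (intro nn_integral_suminf[symmetric]) auto
    also have "\<dots> = (\<integral>\<^sup>+x\<in>S. emeasure \<theta> {y \<in> space \<theta>. x + y \<in> (\<Union>i. A i)} \<partial>\<mu>)"
      by (intro nn_integral_cong) (simp only: ennreal_suminf_multc union split: split_indicator, simp add: union)
    finally show "(\<Sum>i. \<integral>\<^sup>+x\<in>S. emeasure \<theta> {y \<in> space \<theta>. x + y \<in> A i} \<partial>\<mu>)
        = (\<integral>\<^sup>+x\<in>S. emeasure \<theta> {y \<in> space \<theta>. x + y \<in> (\<Union>i. A i)} \<partial>\<mu>)" .
  qed
qed (use assms(3) sets.space_closed in \<open>auto simp: convolve_measures_def positive_def\<close>)

end

theory Submission
  imports Defs
begin

text \<open>
  Balayage at a point is the inequality \<open>h x \<le> \<integral> h d\<theta>\<^sub>x\<close>; integrating it in \<open>x\<close> against \<open>\<mu>\<close> and exchanging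
  the order of integration gives \<open>\<integral> h d\<mu> \<le> \<integral> (\<integral> h d\<theta>\<^sub>x) d\<mu> = \<integral> h d\<nu>\<close> for \<open>\<nu> = \<integral> \<theta> d\<mu>\<close>. Three points need
  care.

  First, a value of \<open>h\<close> or of an integral of \<open>h\<close> may be \<open>-\<infinity>\<close>. An upper semicontinuous function is
  bounded above on compact sets, so the positive parts always have finite integrals, and
  \<open>\<integral> h d\<alpha> \<le> \<integral> h d\<beta>\<close> is equivalent to \<open>\<integral> h\<^sup>+ d\<alpha> + \<integral> h\<^sup>- d\<beta> \<le> \<integral> h\<^sup>+ d\<beta> + \<integral> h\<^sup>- d\<alpha>\<close>
  (\<open>enn2ereal_diff_le_iff\<close>). The latter has no subtraction: it can be integrated termwise, and only
  integrals of nonnegative functions have to be exchanged (\<open>nn_integral_integral_of_measures\<close>).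

  Second, the hypothesis gives measurability of \<open>x \<mapsto> \<integral> f d\<theta>\<^sub>x\<close> only for continuous \<open>f\<close> with compact
  support. Indicators of open sets are limits of such functions, and the open sets form a generator
  of the Borel sets that is closed under intersections, so \<open>x \<mapsto> \<theta>\<^sub>x(B)\<close> is measurable for every
  Borel set \<open>B\<close> (\<open>emeasure_kernel_measurable\<close>).

  Third, convolution is the special case in which \<open>\<theta>\<^sub>x\<close> is the translate of one measure \<open>\<theta>\<close> by \<open>x\<close>
  (\<open>convolve_eq_integral_of_translates\<close>). Harmonicity and subharmonicity are invariant under
  translation and restriction, so if \<open>h\<close> belongs to one of these classes on \<open>U\<close>, then \<open>y \<mapsto> h (x + y)\<close>
  belongs to it on the ball around the origin; hence balayage of the Dirac measure at \<open>0\<close> by \<open>\<theta>\<close>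
  becomes balayage of the Dirac measure at \<open>x\<close> by the translate.
\<close>

section \<open>Measures with compact support\<close>

lemma space_restrict_borel:
  assumes "sets M = sets (restrict_space borel U)"
  shows "space M = U"
  using sets_eq_imp_space_eq[OF assms] by (simp add: space_restrict_space)

lemma sets_restrict_borel_iff:
  assumes "sets M = sets (restrict_space borel U)" "open U"
  shows "A \<in> sets M \<longleftrightarrow> A \<in> sets borel \<and> A \<subseteq> U"
  using assms by (simp add: sets_restrict_space_iff conj_commute)

text \<open>
  A point off the support has a null neighbourhood, which may be taken from a countable base; the
  complement of the support is thus a countable union of null sets.
\<close>

lemma emeasure_outside_support:
  fixes M :: "'a::second_countable_topology measure"
  assumes M: "sets M = sets (restrict_space borel U)" and U: "open U"
  shows "U - measure_support M \<in> null_sets M"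
proof -
  have sp: "space M = U" by (rule space_restrict_borel[OF M])
  obtain B :: "'a set set" where B: "countable B" "topological_basis B"
    using ex_countable_basis by blast
  define N where "N = {b \<in> B. emeasure M (b \<inter> U) = 0}"
  have "(\<Union>b\<in>N. b \<inter> U) \<in> null_sets M"
  proof (rule null_sets_UN')
    show "countable N" using B(1) by (simp add: N_def)
    show "b \<inter> U \<in> null_sets M" if "b \<in> N" for b
      using that B(2) U
      by (auto simp: N_def null_sets_def sets_restrict_borel_iff[OF M U] topological_basis_open)
  qed
  moreover have "U - measure_support M = (\<Union>b\<in>N. b \<inter> U)"
  proof (intro equalityI subsetI)
    fix x assume x: "x \<in> U - measure_support M"
    then obtain V where V: "open V" "x \<in> V" "emeasure M (V \<inter> U) = 0"
      by (auto simp: measure_support_def sp)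
    obtain b where b: "b \<in> B" "x \<in> b" "b \<subseteq> V"
      using topological_basisE[OF B(2) V(1,2)] by blast
    have "emeasure M (b \<inter> U) \<le> emeasure M (V \<inter> U)"
      using b V U by (intro emeasure_mono) (auto simp: sets_restrict_borel_iff[OF M U])
    with b V x show "x \<in> (\<Union>b\<in>N. b \<inter> U)" by (auto simp: N_def)
  next
    fix x assume "x \<in> (\<Union>b\<in>N. b \<inter> U)"
    then show "x \<in> U - measure_support M"
      using topological_basis_open[OF B(2)] by (fastforce simp: N_def measure_support_def sp)
  qed
  ultimately show ?thesis by simp
qed

lemma closedin_measure_support:
  assumes "space M = U"
  shows "closedin (top_of_set U) (measure_support M)"
proof -
  have "openin (top_of_set U) (U - measure_support M)"
  proof (subst openin_subopen, intro ballI)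
    fix x assume "x \<in> U - measure_support M"
    then obtain V where V: "open V" "x \<in> V" "emeasure M (V \<inter> U) = 0" "x \<in> U"
      by (auto simp: measure_support_def assms)
    have "openin (top_of_set U) (U \<inter> V)" using V(1) by (rule openin_open_Int)
    moreover have "U \<inter> V \<subseteq> U - measure_support M"
      using V by (fastforce simp: measure_support_def assms)
    ultimately show "\<exists>T. openin (top_of_set U) T \<and> x \<in> T \<and> T \<subseteq> U - measure_support M"
      using V by blast
  qed
  then show ?thesis
    using assms by (auto simp: closedin_def measure_support_def)
qed

text \<open>
  Finiteness on compact sets yields finiteness of the whole measure, because all of its mass lies on
  its compact support.
\<close>

lemma Meas_cmpD:
  fixes M :: "'a::{second_countable_topology,t2_space} measure"
  assumes "M \<in> Meas_cmp U" "open U"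
  shows "sets M = sets (restrict_space borel U)" "space M = U" "emeasure M U < \<infinity>"
    "measure_support M \<subseteq> U" "compact (measure_support M)"
    "U - measure_support M \<in> null_sets M"
proof -
  show M: "sets M = sets (restrict_space borel U)" and c: "compact (measure_support M)"
    using assms by (auto simp: Meas_cmp_def)
  show sp: "space M = U" by (rule space_restrict_borel[OF M])
  show sub: "measure_support M \<subseteq> U" by (auto simp: measure_support_def sp)
  show null: "U - measure_support M \<in> null_sets M"
    by (rule emeasure_outside_support[OF M assms(2)])
  have "measure_support M \<in> sets M"
    using c sub assms(2) by (simp add: sets_restrict_borel_iff[OF M] compact_imp_closed borel_closed)
  then have "emeasure M (measure_support M \<union> (U - measure_support M)) = emeasure M (measure_support M)"
    by (rule emeasure_Un_null_set) (rule null)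
  moreover have "measure_support M \<union> (U - measure_support M) = U" using sub by auto
  moreover have "emeasure M (measure_support M) < \<infinity>"
    using assms(1) c sub by (auto simp: Meas_cmp_def)
  ultimately show "emeasure M U < \<infinity>" by simp
qed

text \<open>
  A practical criterion: it suffices to find some compact set that carries the measure, since the
  support is closed in \<open>U\<close> and contained in every such set.
\<close>

lemma Meas_cmpI:
  fixes M :: "'a::{second_countable_topology,t2_space} measure"
  assumes M: "sets M = sets (restrict_space borel U)" and U: "open U"
    and fin: "emeasure M U < \<infinity>"
    and L: "compact L" "L \<subseteq> U" "emeasure M (U - L) = 0"
  shows "M \<in> Meas_cmp U" "measure_support M \<subseteq> L"
proof -
  have sp: "space M = U" by (rule space_restrict_borel[OF M])
  show sub: "measure_support M \<subseteq> L"
  proof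
    fix x assume x: "x \<in> measure_support M"
    show "x \<in> L"
    proof (rule ccontr)
      assume "x \<notin> L"
      have "open (U - L)" using U L(1) by (simp add: compact_imp_closed open_Diff)
      moreover have "x \<in> U - L" using x \<open>x \<notin> L\<close> by (auto simp: measure_support_def sp)
      ultimately have "emeasure M ((U - L) \<inter> U) > 0"
        using x unfolding measure_support_def sp by blast
      moreover have "(U - L) \<inter> U = U - L" by auto
      ultimately show False using L(3) by simp
    qed
  qed
  \<comment> \<open>The support is a priori closed in \<open>U\<close> only; inside the compact set \<open>L\<close> it is compact.\<close>
  have "closedin (top_of_set L) (measure_support M)"
    using closedin_measure_support[OF sp] sub L(2) by (rule closedin_subset_trans)
  then have "compact (measure_support M)"
    using L(1) closedin_compact by blast
  moreover have "emeasure M K < \<infinity>" if "compact K" "K \<subseteq> U" for K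
  proof -
    have "emeasure M K \<le> emeasure M U"
      using emeasure_space[of M K] by (simp add: sp)
    with fin show ?thesis by (rule order.strict_trans1[rotated])
  qed
  ultimately show "M \<in> Meas_cmp U" using M by (simp add: Meas_cmp_def)
qed


section \<open>Measurability of a family of measures\<close>

lemma sets_restrict_borel_eq_sigma_sets_open:
  assumes "open U"
  shows "sets (restrict_space borel U) = sigma_sets U {V. open V \<and> V \<subseteq> U}"
proof -
  have "sets (restrict_space borel U) = (\<inter>) U ` sigma_sets UNIV {V. open V}"
    by (simp add: sets_restrict_space borel_def)
  also have "\<dots> = sigma_sets U ((\<inter>) U ` {V. open V})"
    by (rule sigma_sets_Int) (use assms in auto)
  also have "(\<inter>) U ` {V. open V} = {V. open V \<and> V \<subseteq> U}"
    using assms by (auto intro!: image_eqI simp: Int_absorb1)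
  finally show ?thesis .
qed

text \<open>
  Cut-offs built from the distance to the complement. Truncating \<open>V\<close> to a ball makes the supports
  bounded and the complements nonempty (the distance to the empty set would be \<open>0\<close> by convention);
  subtracting \<open>1\<close> keeps the support of the \<open>n\<close>-th function at distance at least \<open>1/n\<close> from the
  complement, hence compact inside \<open>V\<close>.
\<close>

lemma C0_approximates_indicator:
  fixes U V :: "'a::euclidean_space set"
  assumes "open V" "V \<subseteq> U"
  obtains f :: "nat \<Rightarrow> 'a \<Rightarrow> real"
  where "\<And>n. f n \<in> C0 U" "\<And>n x. 0 \<le> f n x" "\<And>n x. f n x \<le> 1"
    "\<And>x. (\<lambda>n. f n x) \<longlonglongrightarrow> indicator V x" "\<And>n. continuous_on UNIV (f n)"
proof -
  define W where "W n = V \<inter> ball 0 (real n)" for n :: nat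
  define f where "f n x = max 0 (min 1 (real n * infdist x (- W n) - 1))" for n x
  have ne: "- W n \<noteq> {}" for n
    using bounded_subset[of "ball 0 (real n)" "W n"] not_bounded_UNIV[where 'a='a]
    by (metis Compl_eq_Diff_UNIV Diff_eq_empty_iff Int_lower2 W_def bounded_ball top.extremum_unique)
  have cl: "closed (- W n)" for n using assms by (auto simp: W_def)
  have cont: "continuous_on UNIV (f n)" for n
    unfolding f_def by (intro continuous_intros)
  have zero: "f n x = 0" if "x \<notin> W n" for n x
    using that by (simp add: f_def)
  have C0: "f n \<in> C0 U" for n
  proof -
    let ?K = "{x. 1 \<le> real n * infdist x (- W n)}"
    have clK: "closed ?K" by (intro closed_Collect_le continuous_intros)
    have KW: "?K \<subseteq> W n"
    proof (intro subsetI, rule ccontr)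
      fix x assume "x \<in> ?K" "x \<notin> W n"
      then show False by simp
    qed
    then have "?K \<subseteq> ball 0 (real n)" by (auto simp: W_def)
    then have "bounded ?K" by (rule bounded_subset[OF bounded_ball])
    then have cK: "compact ?K" using clK by (simp add: compact_eq_bounded_closed)
    have "{x \<in> U. f n x \<noteq> 0} \<subseteq> ?K" by (auto simp: f_def)
    then have sub: "closure {x \<in> U. f n x \<noteq> 0} \<subseteq> ?K" using clK by (rule closure_minimal)
    then have "compact (closure {x \<in> U. f n x \<noteq> 0})"
      using cK by (meson closed_closure compact_eq_bounded_closed bounded_subset)
    moreover have "closure {x \<in> U. f n x \<noteq> 0} \<subseteq> U"
      using sub KW assms(2) by (auto simp: W_def)
    ultimately show ?thesis
      using continuous_on_subset[OF cont] by (auto simp: C0_def)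
  qed
  have lim: "(\<lambda>n. f n x) \<longlonglongrightarrow> indicator V x" for x
  proof (cases "x \<in> V")
    case False
    then show ?thesis using zero[of x] by (simp add: W_def)
  next
    case True
    obtain n0 :: nat where n0: "norm x < real n0" using reals_Archimedean2 by blast
    define a where "a = infdist x (- W n0)"
    have "x \<notin> - W n0" using True n0 by (simp add: W_def)
    then have a: "a > 0"
      unfolding a_def using cl[of n0] ne[of n0] by (simp add: infdist_pos_not_in_closed)
    \<comment> \<open>From here on \<open>n * a > 2\<close>, so the minimum in the cut-off becomes \<open>1\<close>.\<close>
    obtain n1 :: nat where n1: "2 / a < real n1" using reals_Archimedean2 by blast
    have "f n x = 1" if "n \<ge> max n0 n1" for n
    proof -
      have "- W n \<subseteq> - W n0" using that by (auto simp: W_def)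
      then have le: "a \<le> infdist x (- W n)"
        unfolding a_def by (rule infdist_mono) (rule ne)
      have "2 / a < real n" using n1 that by simp
      then have "2 < real n * a" using a by (simp add: field_simps)
      also have "\<dots> \<le> real n * infdist x (- W n)" using le by (simp add: mult_left_mono)
      finally show ?thesis by (simp add: f_def)
    qed
    then have "eventually (\<lambda>n. f n x = 1) sequentially"
      using eventually_sequentially by blast
    then show ?thesis using True by (simp add: tendsto_eventually)
  qed
  show thesis by (rule that[of f]) (use C0 cont lim in \<open>auto simp: f_def\<close>)
qed

text \<open>
  Dominated convergence along the cut-offs settles open sets. The remaining Borel sets follow by
  Dynkin's argument, in which finiteness of the measures is what allows passing to complements.
\<close>

lemma emeasure_kernel_measurable:
  fixes U S :: "'a::euclidean_space set"
  assumes U: "open U"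
    and sets: "\<And>x. x \<in> S \<Longrightarrow> sets (\<theta> x) = sets (restrict_space borel U)"
    and fin: "\<And>x. x \<in> S \<Longrightarrow> emeasure (\<theta> x) U < \<infinity>"
    and C0: "\<And>f. f \<in> C0 U \<Longrightarrow> (\<lambda>x. \<integral>y. f y \<partial>\<theta> x) \<in> borel_measurable (restrict_space borel S)"
    and B: "B \<in> sets (restrict_space borel U)"
  shows "(\<lambda>x. emeasure (\<theta> x) B) \<in> borel_measurable (restrict_space borel S)"
proof -
  have sp: "space (\<theta> x) = U" if "x \<in> S" for x
    by (rule space_restrict_borel[OF sets[OF that]])
  have finm: "finite_measure (\<theta> x)" if "x \<in> S" for x
    using fin[OF that] sp[OF that] by (intro finite_measureI) auto
  have opn: "(\<lambda>x. emeasure (\<theta> x) V) \<in> borel_measurable (restrict_space borel S)"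
    if V: "open V" "V \<subseteq> U" for V
  proof -
    obtain f :: "nat \<Rightarrow> 'a \<Rightarrow> real"
      where f: "\<And>n. f n \<in> C0 U" "\<And>n x. 0 \<le> f n x" "\<And>n x. f n x \<le> 1"
        "\<And>x. (\<lambda>n. f n x) \<longlonglongrightarrow> indicator V x" "\<And>n. continuous_on UNIV (f n)"
      using C0_approximates_indicator[OF V] by blast
    have "(\<lambda>x. measure (\<theta> x) V) \<in> borel_measurable (restrict_space borel S)"
    proof (rule borel_measurable_LIMSEQ_real)
      show "(\<lambda>x. \<integral>y. f n y \<partial>\<theta> x) \<in> borel_measurable (restrict_space borel S)" for n
        by (rule C0[OF f(1)])
      fix x assume "x \<in> space (restrict_space borel S)"
      then have x: "x \<in> S" by (simp add: space_restrict_space)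
      interpret finite_measure "\<theta> x" by (rule finm[OF x])
      have meas: "g \<in> borel_measurable (\<theta> x)" if "g \<in> borel_measurable borel" for g :: "'a \<Rightarrow> real"
        using that by (simp add: measurable_cong_sets[OF sets[OF x] refl] measurable_restrict_space1)
      have Vs: "V \<in> sets (\<theta> x)"
        using V U by (simp add: sets_restrict_borel_iff[OF sets[OF x]])
      have "(\<lambda>n. \<integral>y. f n y \<partial>\<theta> x) \<longlonglongrightarrow> (\<integral>y. indicator V y \<partial>\<theta> x)"
      proof (rule integral_dominated_convergence[where w="\<lambda>_. 1"])
        show "(\<lambda>y. indicator V y :: real) \<in> borel_measurable (\<theta> x)" using V by (intro meas) simp
        show "f n \<in> borel_measurable (\<theta> x)" for n
          using f(5) by (intro meas borel_measurable_continuous_onI)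
      qed (use f in auto)
      then show "(\<lambda>n. \<integral>y. f n y \<partial>\<theta> x) \<longlonglongrightarrow> measure (\<theta> x) V"
        using Vs by simp
    qed
    then have "(\<lambda>x. ennreal (measure (\<theta> x) V)) \<in> borel_measurable (restrict_space borel S)"
      by simp
    then show ?thesis
      by (rule measurable_cong[THEN iffD1, rotated])
        (simp add: space_restrict_space finite_measure.emeasure_eq_measure[OF finm])
  qed
  have "Int_stable {V. open V \<and> V \<subseteq> U}" by (auto simp: Int_stable_def)
  moreover have "{V. open V \<and> V \<subseteq> U} \<subseteq> Pow U" by auto
  moreover have "B \<in> sigma_sets U {V. open V \<and> V \<subseteq> U}"
    using B by (simp add: sets_restrict_borel_eq_sigma_sets_open[OF U])
  ultimately show ?thesis
  proof (induction rule: sigma_sets_induct_disjoint)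
    case (basic A)
    then show ?case by (simp add: opn)
  next
    case empty
    show ?case by simp
  next
    case (compl A)
    have "(\<lambda>x. emeasure (\<theta> x) U - emeasure (\<theta> x) A) \<in> borel_measurable (restrict_space borel S)"
      using opn[OF U] compl.IH by simp
    then show ?case
    proof (rule measurable_cong[THEN iffD1, rotated])
      fix x assume "x \<in> space (restrict_space borel S)"
      then have x: "x \<in> S" by (simp add: space_restrict_space)
      have A: "A \<in> sets (\<theta> x)"
        using compl.hyps by (simp add: sets[OF x] sets_restrict_borel_eq_sigma_sets_open[OF U])
      then show "emeasure (\<theta> x) U - emeasure (\<theta> x) A = emeasure (\<theta> x) (U - A)"
        using emeasure_compl[OF A] finite_measure.emeasure_finite[OF finm[OF x]] by (simp add: sp[OF x])
    qed
  next
    case (union A)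
    have "(\<lambda>x. \<Sum>i. emeasure (\<theta> x) (A i)) \<in> borel_measurable (restrict_space borel S)"
      using union.IH by simp
    then show ?case
    proof (rule measurable_cong[THEN iffD1, rotated])
      fix x assume "x \<in> space (restrict_space borel S)"
      then have x: "x \<in> S" by (simp add: space_restrict_space)
      have "range A \<subseteq> sets (\<theta> x)"
        using union.hyps by (simp add: sets[OF x] sets_restrict_borel_eq_sigma_sets_open[OF U])
      then show "(\<Sum>i. emeasure (\<theta> x) (A i)) = emeasure (\<theta> x) (\<Union>i. A i)"
        using union.hyps by (intro suminf_emeasure) auto
    qed
  qed
qed


section \<open>Integration against an integral of measures\<close>

lemma sets_integral_of_measures: "sets (integral_of_measures S \<theta> \<mu>) = sets \<mu>"
  by (simp add: integral_of_measures_def)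

text \<open>
  The exchange of integrals holds for indicators by the definition of the integral of measures, and
  extends by linearity and monotone convergence. Measurability of the inner integral is part of the
  same induction, because linearity and monotone convergence of the outer integral depend on it.
\<close>

lemma nn_integral_integral_of_measures:
  assumes sets: "\<And>x. x \<in> S \<Longrightarrow> sets (\<theta> x) = sets \<mu>"
    and meas: "\<And>B. B \<in> sets \<mu> \<Longrightarrow> (\<lambda>x. emeasure (\<theta> x) B * indicator S x) \<in> borel_measurable \<mu>"
    and g: "g \<in> borel_measurable \<mu>"
  shows "(\<lambda>x. (\<integral>\<^sup>+y. g y \<partial>\<theta> x) * indicator S x) \<in> borel_measurable \<mu> \<and>
    (\<integral>\<^sup>+y. g y \<partial>integral_of_measures S \<theta> \<mu>) = (\<integral>\<^sup>+x\<in>S. (\<integral>\<^sup>+y. g y \<partial>\<theta> x) \<partial>\<mu>)"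
proof -
  let ?\<nu> = "integral_of_measures S \<theta> \<mu>"
  have ms: "f \<in> borel_measurable (\<theta> x)" if "f \<in> borel_measurable \<mu>" "x \<in> S" for x and f :: "_ \<Rightarrow> ennreal"
    using that by (simp add: measurable_cong_sets[OF sets])
  have mn: "f \<in> borel_measurable ?\<nu>" if "f \<in> borel_measurable \<mu>" for f :: "_ \<Rightarrow> ennreal"
    using that by (simp add: measurable_cong_sets[OF sets_integral_of_measures])
  have sp: "space (\<theta> x) = space \<mu>" if "x \<in> S" for x
    using sets_eq_imp_space_eq[OF sets[OF that]] .
  have spn: "space ?\<nu> = space \<mu>"
    using sets_eq_imp_space_eq[OF sets_integral_of_measures] .
  from g show ?thesis
  proof (induction rule: borel_measurable_induct)
    case (cong f g)
    have "(\<integral>\<^sup>+y. f y \<partial>?\<nu>) = (\<integral>\<^sup>+y. g y \<partial>?\<nu>)"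
      using cong by (intro nn_integral_cong) (simp add: spn)
    moreover have "(\<integral>\<^sup>+y. f y \<partial>\<theta> x) * indicator S x = (\<integral>\<^sup>+y. g y \<partial>\<theta> x) * indicator S x" for x
      using cong by (cases "x \<in> S") (auto simp: sp intro!: nn_integral_cong)
    ultimately show ?case using cong by simp
  next
    case (set A)
    have "(\<integral>\<^sup>+y. indicator A y \<partial>\<theta> x) * indicator S x = emeasure (\<theta> x) A * indicator S x" for x
      using set by (cases "x \<in> S") (auto simp: sets)
    moreover have "(\<integral>\<^sup>+y. indicator A y \<partial>?\<nu>) = emeasure ?\<nu> A"
      using set by (simp add: sets_integral_of_measures)
    ultimately show ?case
      using meas[OF set] emeasure_integral_of_measures[OF sets meas set] by simp
  next
    case (mult u c)
    have eq: "(\<integral>\<^sup>+y. c * u y \<partial>\<theta> x) * indicator S x = c * ((\<integral>\<^sup>+y. u y \<partial>\<theta> x) * indicator S x)" for x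
      using mult by (cases "x \<in> S") (auto simp: nn_integral_cmult ms)
    have [measurable]: "(\<lambda>x. (\<integral>\<^sup>+y. u y \<partial>\<theta> x) * indicator S x) \<in> borel_measurable \<mu>"
      using mult by blast
    show ?case
      using mult by (simp add: eq nn_integral_cmult mn)
  next
    case (add u v)
    have eq: "(\<integral>\<^sup>+y. v y + u y \<partial>\<theta> x) * indicator S x =
      (\<integral>\<^sup>+y. v y \<partial>\<theta> x) * indicator S x + (\<integral>\<^sup>+y. u y \<partial>\<theta> x) * indicator S x" for x
      using add by (cases "x \<in> S") (auto simp: nn_integral_add ms)
    have [measurable]: "(\<lambda>x. (\<integral>\<^sup>+y. u y \<partial>\<theta> x) * indicator S x) \<in> borel_measurable \<mu>"
      "(\<lambda>x. (\<integral>\<^sup>+y. v y \<partial>\<theta> x) * indicator S x) \<in> borel_measurable \<mu>"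
      using add by blast+
    show ?case
      using add by (simp add: eq nn_integral_add mn)
  next
    case (seq F)
    have eq: "(\<integral>\<^sup>+y. (SUP i. F i) y \<partial>\<theta> x) * indicator S x =
      (SUP i. (\<integral>\<^sup>+y. F i y \<partial>\<theta> x) * indicator S x)" for x
    proof (cases "x \<in> S")
      case True
      then show ?thesis
        using seq by (simp add: nn_integral_monotone_convergence_SUP ms image_comp)
    qed simp
    have inc: "incseq (\<lambda>i x. (\<integral>\<^sup>+y. F i y \<partial>\<theta> x) * indicator S x)"
      using seq(3) by (auto simp: incseq_def le_fun_def intro!: mult_right_mono nn_integral_mono)
    have "(\<integral>\<^sup>+y. (SUP i. F i) y \<partial>?\<nu>) = (SUP i. \<integral>\<^sup>+y. F i y \<partial>?\<nu>)"
      using seq by (simp add: nn_integral_monotone_convergence_SUP mn image_comp)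
    also have "\<dots> = (SUP i. \<integral>\<^sup>+x\<in>S. (\<integral>\<^sup>+y. F i y \<partial>\<theta> x) \<partial>\<mu>)"
      using seq by simp
    also have "\<dots> = (\<integral>\<^sup>+x. (SUP i. (\<integral>\<^sup>+y. F i y \<partial>\<theta> x) * indicator S x) \<partial>\<mu>)"
      using seq inc by (intro nn_integral_monotone_convergence_SUP[symmetric]) auto
    finally have "(\<integral>\<^sup>+y. (SUP i. F i) y \<partial>?\<nu>)
        = (\<integral>\<^sup>+x. (SUP i. (\<integral>\<^sup>+y. F i y \<partial>\<theta> x) * indicator S x) \<partial>\<mu>)" .
    moreover have "(\<lambda>x. SUP i. (\<integral>\<^sup>+y. F i y \<partial>\<theta> x) * indicator S x) \<in> borel_measurable \<mu>"
      using seq by (intro borel_measurable_SUP) auto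
    ultimately show ?case unfolding eq by blast
  qed
qed


section \<open>Upper semicontinuous functions\<close>

lemma usc_measurable:
  assumes "h \<in> usc U" "open U"
  shows "h \<in> borel_measurable (restrict_space borel U)"
proof (rule borel_measurableI_less)
  fix c
  have "open {x \<in> U. h x < c}"
    using assms by (auto simp: usc_def openin_open_eq)
  moreover have "{x \<in> space (restrict_space borel U). h x < c} = {x \<in> U. h x < c}"
    by (simp add: space_restrict_space)
  ultimately show "{x \<in> space (restrict_space borel U). h x < c} \<in> sets (restrict_space borel U)"
    using assms(2) by (simp add: sets_restrict_space_iff subset_iff)
qed

text \<open>
  The open sublevel sets of levels \<open>0, 1, 2, \<dots>\<close> cover \<open>K\<close>, because \<open>h\<close> does not take the value \<open>\<infinity>\<close>;
  the sum of the finitely many levels in a subcover is an upper bound.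
\<close>

lemma usc_bounded_above_on_compact:
  assumes h: "h \<in> usc U" and U: "open U" and K: "compact K" "K \<subseteq> U"
  obtains M :: real where "\<And>x. x \<in> K \<Longrightarrow> h x \<le> ereal M"
proof -
  let ?C = "\<lambda>n::nat. {x \<in> U. h x < ereal (real n)}"
  have op: "open (?C n)" for n
    using h U by (auto simp: usc_def openin_open_eq)
  have cov: "K \<subseteq> (\<Union>n\<in>UNIV. ?C n)"
  proof
    fix x assume x: "x \<in> K"
    then have "h x \<noteq> \<infinity>" using h K(2) by (force simp: usc_def)
    then obtain n :: nat where "h x < ereal (real n)"
      using less_PInf_Ex_of_nat by blast
    then show "x \<in> (\<Union>n\<in>UNIV. ?C n)" using x K(2) by auto
  qed
  obtain C' where C': "C' \<subseteq> UNIV" "finite C'" "K \<subseteq> (\<Union>n\<in>C'. ?C n)"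
    by (rule compactE_image[OF K(1) op cov])
  show thesis
  proof (rule that[of "real (\<Sum>n\<in>C'. n)"])
    fix x assume "x \<in> K"
    then obtain n where n: "n \<in> C'" "h x < ereal (real n)" using C'(3) by auto
    have "n \<le> (\<Sum>n\<in>C'. n)" using n(1) C'(2) by (intro member_le_sum) auto
    then have "ereal (real n) \<le> ereal (real (\<Sum>n\<in>C'. n))" by (simp del: of_nat_sum)
    with n(2) show "h x \<le> ereal (real (\<Sum>n\<in>C'. n))" by (rule order.trans[OF less_imp_le])
  qed
qed

lemma nn_integral_pos_part_usc_finite:
  fixes M :: "'a::{second_countable_topology,t2_space} measure"
  assumes h: "h \<in> usc U" and U: "open U" and M: "M \<in> Meas_cmp U"
  shows "(\<integral>\<^sup>+x. e2ennreal (h x) \<partial>M) < \<infinity>"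
proof -
  note M = Meas_cmpD[OF M U]
  obtain C :: real where C: "\<And>x. x \<in> measure_support M \<Longrightarrow> h x \<le> ereal C"
    using usc_bounded_above_on_compact[OF h U M(5,4)] by blast
  have "(\<integral>\<^sup>+x. e2ennreal (h x) \<partial>M) \<le> (\<integral>\<^sup>+x. ennreal C \<partial>M)"
  proof (rule nn_integral_mono_AE)
    have "AE x in M. x \<notin> U - measure_support M" by (rule AE_not_in[OF M(6)])
    then show "AE x in M. e2ennreal (h x) \<le> ennreal C"
      using AE_space
    proof eventually_elim
      case (elim x)
      then have "h x \<le> ereal C" using C M(2) by auto
      then have "e2ennreal (h x) \<le> e2ennreal (ereal C)" by (rule e2ennreal_mono)
      then show ?case by (simp add: ennreal.abs_eq)
    qed
  qed
  also have "\<dots> < \<infinity>" using M(2,3) by (simp add: ennreal_mult_less_top)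
  finally show ?thesis .
qed


section \<open>Balayage by integrals of measures\<close>

text \<open>
  This removes subtraction from a comparison of extended real integrals: \<open>a\<close>, \<open>b\<close> and \<open>p\<close>, \<open>n\<close> stand
  for the integrals of the positive and negative parts with respect to two measures. If \<open>b\<close> is
  infinite, both sides are true; if only \<open>n\<close> is, both are false.
\<close>

lemma enn2ereal_diff_le_iff:
  assumes "a < \<infinity>" "p < \<infinity>"
  shows "enn2ereal a - enn2ereal b \<le> enn2ereal p - enn2ereal n \<longleftrightarrow> a + n \<le> p + b"
proof -
  obtain a' where a: "0 \<le> a'" "a = ennreal a'" using assms(1) by (cases a) auto
  obtain p' where p: "0 \<le> p'" "p = ennreal p'" using assms(2) by (cases p) auto
  show ?thesis
  proof (cases "b = top \<or> n = top")
    case True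
    then consider "b = top" | b' where "n = top" "0 \<le> b'" "b = ennreal b'"
      by (cases b) auto
    then show ?thesis
    proof cases
      case 1
      then show ?thesis by (simp add: a p enn2ereal_ennreal top_ennreal.rep_eq)
    next
      case 2
      then have "p + b = ennreal (p' + b')" using p by simp
      then have "\<not> a + n \<le> p + b" using 2 by (simp add: top_unique del: ennreal_plus)
      moreover have "\<not> enn2ereal a - enn2ereal b \<le> enn2ereal p - enn2ereal n"
        using 2 by (simp add: a p enn2ereal_ennreal top_ennreal.rep_eq)
      ultimately show ?thesis by blast
    qed
  next
    case False
    then obtain b' n' where b: "0 \<le> b'" "b = ennreal b'" and n: "0 \<le> n'" "n = ennreal n'"
      by (cases b; cases n) auto
    have "a + n = ennreal (a' + n')" "p + b = ennreal (p' + b')"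
      using a b n p by simp_all
    then show ?thesis
      using a b n p by (auto simp: enn2ereal_ennreal ennreal_le_iff simp del: ennreal_plus)
  qed
qed

lemma ereal_integral_dirac:
  assumes U: "open U" and x: "x \<in> U" and h: "h \<in> usc U"
  shows "ereal_integral (dirac U x) h = enn2ereal (e2ennreal (h x)) - enn2ereal (e2ennreal (- h x))"
proof -
  have [measurable]: "h \<in> borel_measurable (restrict_space borel U)"
    by (rule usc_measurable[OF h U])
  show ?thesis
    using x unfolding ereal_integral_def dirac_def
    by (subst (1 2) nn_integral_return) (auto simp: space_restrict_space)
qed

text \<open>
  The new measure lives on the compact closure of all the supports and has total mass at most
  \<open>sup \<theta>\<^sub>x(U)\<close> times that of \<open>\<mu>\<close>. For the balayage, the pointwise inequality, written without
  subtraction, is integrated over \<open>S\<close>, which carries \<open>\<mu>\<close>.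
\<close>

lemma balayage_integral_of_measures:
  fixes U S :: "'a::euclidean_space set"
  assumes U: "open U" and S: "S \<in> sets borel" "S \<subseteq> U"
    and \<mu>: "\<mu> \<in> Meas_cmp U" "measure_support \<mu> \<subseteq> S"
    and \<theta>: "\<And>x. x \<in> S \<Longrightarrow> \<theta> x \<in> Meas_cmp U"
    and L: "compact (closure (\<Union>x\<in>S. measure_support (\<theta> x)))"
      "closure (\<Union>x\<in>S. measure_support (\<theta> x)) \<subseteq> U"
    and bdd: "(SUP x\<in>S. emeasure (\<theta> x) U) < \<infinity>"
    and C0: "\<And>f. f \<in> C0 U \<Longrightarrow> (\<lambda>x. \<integral>y. f y \<partial>\<theta> x) \<in> borel_measurable (restrict_space borel S)"
  shows "integral_of_measures S \<theta> \<mu> \<in> Meas_cmp U"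
    and "\<lbrakk>H \<subseteq> usc U; \<And>x. x \<in> S \<Longrightarrow> balayage H (dirac U x) (\<theta> x)\<rbrakk>
      \<Longrightarrow> balayage H \<mu> (integral_of_measures S \<theta> \<mu>)"
proof -
  let ?\<nu> = "integral_of_measures S \<theta> \<mu>"
  let ?L = "closure (\<Union>x\<in>S. measure_support (\<theta> x))"
  note \<mu>D = Meas_cmpD[OF \<mu>(1) U]
  note \<theta>D = Meas_cmpD[OF \<theta> U]
  have sets: "sets (\<theta> x) = sets \<mu>" if "x \<in> S" for x
    using \<theta>D(1)[OF that] \<mu>D(1) by simp
  have S': "S \<in> sets \<mu>" using S U by (simp add: sets_restrict_borel_iff[OF \<mu>D(1)])
  have meas: "(\<lambda>x. emeasure (\<theta> x) B * indicator S x) \<in> borel_measurable \<mu>" if "B \<in> sets \<mu>" for B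
  proof -
    have "(\<lambda>x. emeasure (\<theta> x) B) \<in> borel_measurable (restrict_space borel S)"
      using that by (intro emeasure_kernel_measurable[OF U \<theta>D(1,3) C0]) (simp_all add: \<mu>D(1))
    then have "(\<lambda>x. emeasure (\<theta> x) B * indicator S x) \<in> borel_measurable borel"
      using S(1) by (simp add: borel_measurable_restrict_space_iff_ennreal)
    then show ?thesis
      by (simp add: measurable_cong_sets[OF \<mu>D(1) refl] measurable_restrict_space1)
  qed
  have em: "emeasure ?\<nu> B = (\<integral>\<^sup>+x\<in>S. emeasure (\<theta> x) B \<partial>\<mu>)" if "B \<in> sets \<mu>" for B
    using that by (intro emeasure_integral_of_measures sets meas)
  have nn: "(\<lambda>x. (\<integral>\<^sup>+y. g y \<partial>\<theta> x) * indicator S x) \<in> borel_measurable \<mu> \<and>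
    (\<integral>\<^sup>+y. g y \<partial>?\<nu>) = (\<integral>\<^sup>+x\<in>S. (\<integral>\<^sup>+y. g y \<partial>\<theta> x) \<partial>\<mu>)" if "g \<in> borel_measurable \<mu>" for g
    using that by (intro nn_integral_integral_of_measures sets meas)
  have \<nu>s: "sets ?\<nu> = sets (restrict_space borel U)"
    using \<mu>D(1) by (simp add: sets_integral_of_measures)
  show \<nu>: "?\<nu> \<in> Meas_cmp U"
  proof (rule Meas_cmpI(1)[OF \<nu>s U _ L])
    let ?C = "SUP x\<in>S. emeasure (\<theta> x) U"
    have "U \<in> sets \<mu>" using \<mu>D(2) by auto
    then have "emeasure ?\<nu> U = (\<integral>\<^sup>+x\<in>S. emeasure (\<theta> x) U \<partial>\<mu>)" by (rule em)
    also have "\<dots> \<le> (\<integral>\<^sup>+x. ?C \<partial>\<mu>)"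
      by (intro nn_integral_mono) (auto split: split_indicator intro: SUP_upper)
    also have "\<dots> < \<infinity>" using bdd \<mu>D(2,3) by (simp add: ennreal_mult_less_top)
    finally show "emeasure ?\<nu> U < \<infinity>" .
    have UL: "U - ?L \<in> sets \<mu>" using U by (simp add: sets_restrict_borel_iff[OF \<mu>D(1)])
    have "emeasure (\<theta> x) (U - ?L) = 0" if x: "x \<in> S" for x
    proof -
      have "emeasure (\<theta> x) (U - ?L) \<le> emeasure (\<theta> x) (U - measure_support (\<theta> x))"
        using \<theta>D(6)[OF x] closure_subset[of "\<Union>x\<in>S. measure_support (\<theta> x)"] x
        by (intro emeasure_mono) auto
      then show ?thesis using \<theta>D(6)[OF x] by (simp add: null_sets_def)
    qed
    then have "(\<integral>\<^sup>+x\<in>S. emeasure (\<theta> x) (U - ?L) \<partial>\<mu>) = (\<integral>\<^sup>+x. 0 \<partial>\<mu>)"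
      by (intro nn_integral_cong) (simp split: split_indicator)
    then show "emeasure ?\<nu> (U - ?L) = 0" using em[OF UL] by simp
  qed
  have onS: "(\<integral>\<^sup>+x. f x \<partial>\<mu>) = (\<integral>\<^sup>+x\<in>S. f x \<partial>\<mu>)" for f
  proof (rule nn_integral_cong_AE)
    have "AE x in \<mu>. x \<in> S"
      using AE_not_in[OF \<mu>D(6)] AE_space by eventually_elim (use \<mu>(2) \<mu>D(2) in auto)
    then show "AE x in \<mu>. f x = f x * indicator S x" by eventually_elim simp
  qed
  assume H: "H \<subseteq> usc U" and bal: "\<And>x. x \<in> S \<Longrightarrow> balayage H (dirac U x) (\<theta> x)"
  show "balayage H \<mu> ?\<nu>"
    unfolding balayage_def
  proof
    fix h assume hH: "h \<in> H"
    then have h: "h \<in> usc U" using H by auto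
    have hm[measurable]: "h \<in> borel_measurable \<mu>"
      using usc_measurable[OF h U] by (simp add: measurable_cong_sets[OF \<mu>D(1) refl])
    let ?p = "\<lambda>y. e2ennreal (h y)" and ?n = "\<lambda>y. e2ennreal (- h y)"
    have pm[measurable]: "?p \<in> borel_measurable \<mu>" and nm[measurable]: "?n \<in> borel_measurable \<mu>"
      by measurable
    note P = nn[OF pm] and N = nn[OF nm]
    have pt: "?p x + (\<integral>\<^sup>+y. ?n y \<partial>\<theta> x) \<le> (\<integral>\<^sup>+y. ?p y \<partial>\<theta> x) + ?n x" if x: "x \<in> S" for x
    proof -
      have xU: "x \<in> U" using x S by auto
      have "h x < \<infinity>" using h xU by (auto simp: usc_def)
      then have fin: "?p x < \<infinity>" by (cases "h x") (auto simp: e2ennreal_neg)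
      have "ereal_integral (dirac U x) h \<le> ereal_integral (\<theta> x) h"
        using bal[OF x] hH by (simp add: balayage_def)
      then show ?thesis
        unfolding ereal_integral_dirac[OF U xU h] unfolding ereal_integral_def
        using enn2ereal_diff_le_iff[OF fin nn_integral_pos_part_usc_finite[OF h U \<theta>[OF x]]]
        by blast
    qed
    have "(\<integral>\<^sup>+x. ?p x \<partial>\<mu>) + (\<integral>\<^sup>+x. ?n x \<partial>?\<nu>)
        = (\<integral>\<^sup>+x. ?p x * indicator S x + (\<integral>\<^sup>+y. ?n y \<partial>\<theta> x) * indicator S x \<partial>\<mu>)"
      unfolding onS[of ?p] N[THEN conjunct2]
      using N S' by (intro nn_integral_add[symmetric]) auto
    also have "\<dots> \<le> (\<integral>\<^sup>+x. (\<integral>\<^sup>+y. ?p y \<partial>\<theta> x) * indicator S x + ?n x * indicator S x \<partial>\<mu>)"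
      using pt by (intro nn_integral_mono) (auto split: split_indicator)
    also have "\<dots> = (\<integral>\<^sup>+x. ?p x \<partial>?\<nu>) + (\<integral>\<^sup>+x. ?n x \<partial>\<mu>)"
      unfolding onS[of ?n] P[THEN conjunct2]
      using P S' by (intro nn_integral_add) auto
    finally show "ereal_integral \<mu> h \<le> ereal_integral ?\<nu> h"
      unfolding ereal_integral_def
      by (subst enn2ereal_diff_le_iff)
        (use nn_integral_pos_part_usc_finite[OF h U] \<mu>(1) \<nu> in auto)
  qed
qed


section \<open>Translates of harmonic and subharmonic functions\<close>

lemma harmonic_on_translate:
  assumes "harmonic_on u U" and sub: "\<And>y. y \<in> V \<Longrightarrow> a + y \<in> U"
  shows "harmonic_on (\<lambda>y. u (a + y)) V"
proof -
  obtain u' u'' where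
    u': "\<And>x. x \<in> U \<Longrightarrow> (u has_derivative blinfun_apply (u' x)) (at x)" and
    u'': "\<And>x. x \<in> U \<Longrightarrow> (u' has_derivative blinfun_apply (u'' x)) (at x)" and
    c: "continuous_on U u''" and
    l: "\<And>x. x \<in> U \<Longrightarrow> (\<Sum>b\<in>Basis. blinfun_apply (blinfun_apply (u'' x) b) b) = 0"
    using assms(1) unfolding harmonic_on_def by (elim exE conjE) blast
  have sh: "((\<lambda>y. a + y) has_derivative (\<lambda>y. y)) (at y)" for y
    by (auto intro!: derivative_eq_intros)
  show ?thesis
    unfolding harmonic_on_def
  proof (intro exI[of _ "\<lambda>y. u' (a + y)"] exI[of _ "\<lambda>y. u'' (a + y)"] conjI ballI)
    fix y assume y: "y \<in> V"
    show "((\<lambda>y. u (a + y)) has_derivative blinfun_apply (u' (a + y))) (at y)"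
      using has_derivative_compose[OF sh u'[OF sub[OF y]]] by simp
    show "((\<lambda>y. u' (a + y)) has_derivative blinfun_apply (u'' (a + y))) (at y)"
      using has_derivative_compose[OF sh u''[OF sub[OF y]]] by simp
    show "(\<Sum>b\<in>Basis. blinfun_apply (blinfun_apply (u'' (a + y)) b) b) = 0"
      by (rule l[OF sub[OF y]])
  next
    show "continuous_on V (\<lambda>y. u'' (a + y))"
      by (rule continuous_on_compose2[OF c]) (auto intro!: continuous_intros sub)
  qed
qed

lemma har_translate:
  assumes "h \<in> har U" and sub: "\<And>y. y \<in> V \<Longrightarrow> a + y \<in> U"
  shows "(\<lambda>y. h (a + y)) \<in> har V"
proof -
  obtain u where "harmonic_on u U" and "\<And>x. x \<in> U \<Longrightarrow> h x = ereal (u x)"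
    using assms(1) unfolding har_def by blast
  then have "harmonic_on (\<lambda>y. u (a + y)) V" "\<forall>y\<in>V. h (a + y) = ereal (u (a + y))"
    using sub by (auto intro: harmonic_on_translate)
  then show ?thesis
    unfolding har_def by (intro CollectI exI[of _ "\<lambda>y. u (a + y)"] conjI)
qed

lemma usc_translate:
  fixes h :: "'a::real_normed_vector \<Rightarrow> ereal"
  assumes h: "h \<in> usc U" and sub: "\<And>y. y \<in> V \<Longrightarrow> a + y \<in> U"
  shows "(\<lambda>y. h (a + y)) \<in> usc V"
  unfolding usc_def
proof (intro CollectI conjI ballI allI)
  show "h (a + y) < \<infinity>" if "y \<in> V" for y
    using h sub[OF that] by (auto simp: usc_def)
  fix c
  have "openin (top_of_set U) {x \<in> U. h x < c}" using h by (auto simp: usc_def)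
  moreover have "continuous_on V (\<lambda>y. a + y)" by (intro continuous_intros)
  ultimately have "openin (top_of_set V) (V \<inter> (\<lambda>y. a + y) -` {x \<in> U. h x < c})"
    using sub by (intro continuous_openin_preimage[of _ _ U]) auto
  also have "V \<inter> (\<lambda>y. a + y) -` {x \<in> U. h x < c} = {y \<in> V. h (a + y) < c}"
    using sub by auto
  finally show "openin (top_of_set V) {y \<in> V. h (a + y) < c}" .
qed

text \<open>
  A harmonic majorant of the translated function on a sphere in \<open>V\<close> is moved forward by \<open>a\<close> to a
  harmonic majorant of \<open>h\<close> on a sphere in \<open>U\<close>, where the comparison property of \<open>h\<close> applies.
\<close>

lemma sbh_translate:
  fixes h :: "'a::euclidean_space \<Rightarrow> ereal"
  assumes h: "h \<in> sbh U" and sub: "\<And>y. y \<in> V \<Longrightarrow> a + y \<in> U"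
  shows "(\<lambda>y. h (a + y)) \<in> sbh V"
  unfolding sbh_def
proof (intro CollectI conjI allI impI ballI)
  have "h \<in> usc U" using h by (simp add: sbh_def)
  then show "(\<lambda>y. h (a + y)) \<in> usc V" using sub by (rule usc_translate)
  fix z r u y
  assume r: "0 < r" and cb: "cball z r \<subseteq> V" and c: "continuous_on (cball z r) u"
    and u: "harmonic_on u (ball z r)" and b: "\<forall>y\<in>sphere z r. h (a + y) \<le> ereal (u y)"
    and y: "y \<in> ball z r"
  have shift: "dist (a + z) w = dist z (- a + w)" for w
    by (simp add: dist_norm algebra_simps)
  let ?u = "\<lambda>w. u (- a + w)"
  have comparison: "\<forall>w\<in>ball (a + z) r. h w \<le> ereal (?u w)"
    if "cball (a + z) r \<subseteq> U" "continuous_on (cball (a + z) r) ?u"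
      "harmonic_on ?u (ball (a + z) r)" "\<forall>w\<in>sphere (a + z) r. h w \<le> ereal (?u w)"
    using h r that unfolding sbh_def by blast
  have "\<forall>w\<in>ball (a + z) r. h w \<le> ereal (?u w)"
  proof (rule comparison)
    show "cball (a + z) r \<subseteq> U"
    proof
      fix w assume "w \<in> cball (a + z) r"
      then have "- a + w \<in> V" using cb by (auto simp: shift)
      from sub[OF this] show "w \<in> U" by simp
    qed
    show "continuous_on (cball (a + z) r) ?u"
      by (rule continuous_on_compose2[OF c]) (auto intro!: continuous_intros simp: shift)
    show "harmonic_on ?u (ball (a + z) r)"
      by (rule harmonic_on_translate[OF u]) (simp add: shift)
    show "\<forall>w\<in>sphere (a + z) r. h w \<le> ereal (?u w)"
    proof
      fix w assume "w \<in> sphere (a + z) r"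
      then have "- a + w \<in> sphere z r" by (simp add: shift)
      from bspec[OF b this] show "h w \<le> ereal (?u w)" by simp
    qed
  qed
  moreover have "a + y \<in> ball (a + z) r" using y by (simp add: shift)
  ultimately have "h (a + y) \<le> ereal (?u (a + y))" by (rule bspec)
  then show "h (a + y) \<le> ereal (u y)" by simp
qed

lemma har_subset_usc: "har U \<subseteq> usc U"
proof
  fix h :: "'a \<Rightarrow> ereal" assume "h \<in> har U"
  then obtain u where u: "harmonic_on u U" and hu: "\<And>x. x \<in> U \<Longrightarrow> h x = ereal (u x)"
    unfolding har_def by blast
  have "continuous_on U u"
    using u unfolding harmonic_on_def
    by (meson continuous_at_imp_continuous_on has_derivative_continuous)
  then have c: "continuous_on U (\<lambda>x. ereal (u x))" by (intro continuous_intros)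
  have "openin (top_of_set U) {x \<in> U. h x < c}" for c
  proof -
    have "openin (top_of_set U) (U \<inter> (\<lambda>x. ereal (u x)) -` {..<c})"
      using c by (rule continuous_openin_preimage_gen) simp
    also have "U \<inter> (\<lambda>x. ereal (u x)) -` {..<c} = {x \<in> U. h x < c}" using hu by auto
    finally show ?thesis .
  qed
  then show "h \<in> usc U" using hu by (simp add: usc_def)
qed


section \<open>Convolution as an integral of translates\<close>

definition translate_measure :: "'a::euclidean_space set \<Rightarrow> 'a measure \<Rightarrow> 'a \<Rightarrow> 'a measure" where
  "translate_measure U \<theta> x = distr \<theta> (restrict_space borel U) (\<lambda>y. x + y)"

context
  fixes U V :: "'a::euclidean_space set" and \<theta> :: "'a measure" and x :: 'a
  assumes U: "open U" and V: "open V" and \<theta>: "\<theta> \<in> Meas_cmp V"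
    and sub: "\<And>y. y \<in> V \<Longrightarrow> x + y \<in> U"
begin

lemma translate_measurable: "(\<lambda>y. x + y) \<in> \<theta> \<rightarrow>\<^sub>M restrict_space borel U"
proof -
  have "(\<lambda>y. x + y) \<in> restrict_space borel V \<rightarrow>\<^sub>M restrict_space borel U"
    using sub by (intro measurable_restrict_space2) (auto simp: space_restrict_space intro!: measurable_restrict_space1)
  then show ?thesis by (simp add: measurable_cong_sets[OF Meas_cmpD(1)[OF \<theta> V] refl])
qed

lemma emeasure_translate_measure:
  assumes "B \<in> sets (restrict_space borel U)"
  shows "emeasure (translate_measure U \<theta> x) B = emeasure \<theta> {y \<in> space \<theta>. x + y \<in> B}"
proof -
  have "(\<lambda>y. x + y) -` B \<inter> space \<theta> = {y \<in> space \<theta>. x + y \<in> B}" by auto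
  then show ?thesis
    unfolding translate_measure_def by (simp add: emeasure_distr[OF translate_measurable assms])
qed

lemma emeasure_translate_measure_space:
  "emeasure (translate_measure U \<theta> x) U = emeasure \<theta> V"
proof -
  have "{y \<in> space \<theta>. x + y \<in> U} = V" using sub by (auto simp: Meas_cmpD(2)[OF \<theta> V])
  then show ?thesis using U by (subst emeasure_translate_measure) (auto simp: sets_restrict_space_iff)
qed

lemma translate_measure_Meas_cmp:
  "translate_measure U \<theta> x \<in> Meas_cmp U"
  "measure_support (translate_measure U \<theta> x) \<subseteq> (\<lambda>y. x + y) ` V"
proof -
  note D = Meas_cmpD[OF \<theta> V]
  let ?K = "(\<lambda>y. x + y) ` measure_support \<theta>"
  have K: "compact ?K" using D(5) by (rule compact_continuous_image[rotated]) (intro continuous_intros)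
  have sets: "sets (translate_measure U \<theta> x) = sets (restrict_space borel U)"
    by (simp add: translate_measure_def)
  have fin: "emeasure (translate_measure U \<theta> x) U < \<infinity>"
    using D(3) by (simp add: emeasure_translate_measure_space)
  have KU: "?K \<subseteq> U" using D(4) sub by auto
  have "{y \<in> space \<theta>. x + y \<in> U - ?K} = V - measure_support \<theta>" using sub D(2) by auto
  moreover have "U - ?K \<in> sets (restrict_space borel U)"
    using U K by (simp add: sets_restrict_borel_iff[OF refl U] compact_imp_closed borel_closed sets.Diff)
  ultimately have "emeasure (translate_measure U \<theta> x) (U - ?K) = 0"
    using D(6) by (simp add: emeasure_translate_measure null_sets_def)
  note I = Meas_cmpI[OF sets U fin K KU this]
  show "translate_measure U \<theta> x \<in> Meas_cmp U" by (rule I(1))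
  show "measure_support (translate_measure U \<theta> x) \<subseteq> (\<lambda>y. x + y) ` V" using I(2) D(4) by auto
qed

lemma ereal_integral_translate_measure:
  assumes "h \<in> usc U"
  shows "ereal_integral (translate_measure U \<theta> x) h = ereal_integral \<theta> (\<lambda>y. h (x + y))"
proof -
  have [measurable]: "h \<in> borel_measurable (restrict_space borel U)"
    by (rule usc_measurable[OF assms U])
  show ?thesis
    unfolding ereal_integral_def translate_measure_def
    by (subst (1 2) nn_integral_distr[OF translate_measurable]) simp_all
qed

text \<open>
  Both sides of the inequality for \<open>h\<close> at \<open>x\<close> are those of the inequality for \<open>y \<mapsto> h (x + y)\<close> at the
  origin. Two classes are involved because \<open>h\<close> is a function on \<open>U\<close> and its translate one on \<open>V\<close>.
\<close>

lemma balayage_translate_measure: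
  assumes x: "x \<in> U" "0 \<in> V" and H: "H \<subseteq> usc U" "\<And>h. h \<in> H \<Longrightarrow> (\<lambda>y. h (x + y)) \<in> H'"
    and bal: "balayage H' (dirac V 0) \<theta>"
  shows "balayage H (dirac U x) (translate_measure U \<theta> x)"
  unfolding balayage_def
proof
  fix h assume h: "h \<in> H"
  then have hu: "h \<in> usc U" using H(1) by auto
  have "ereal_integral (dirac U x) h = ereal_integral (dirac V 0) (\<lambda>y. h (x + y))"
    using ereal_integral_dirac[OF U x(1) hu] ereal_integral_dirac[OF V x(2) usc_translate[OF hu sub]]
    by simp
  also have "\<dots> \<le> ereal_integral \<theta> (\<lambda>y. h (x + y))"
    using bal H(2)[OF h] by (simp add: balayage_def)
  also have "\<dots> = ereal_integral (translate_measure U \<theta> x) h"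
    by (rule ereal_integral_translate_measure[OF hu, symmetric])
  finally show "ereal_integral (dirac U x) h \<le> ereal_integral (translate_measure U \<theta> x) h" .
qed

end

text \<open>
  The integral is \<open>\<integral> f (x + y) d\<theta>(y)\<close>, so that joint measurability in \<open>x\<close> and \<open>y\<close> and Fubini suffice.
\<close>

lemma integral_translate_measure_measurable:
  fixes U V S :: "'a::euclidean_space set" and f :: "'a \<Rightarrow> real"
  assumes U: "open U" and V: "open V" and \<theta>: "\<theta> \<in> Meas_cmp V"
    and sub: "\<And>x y. x \<in> S \<Longrightarrow> y \<in> V \<Longrightarrow> x + y \<in> U" and f: "continuous_on U f"
  shows "(\<lambda>x. \<integral>y. f y \<partial>translate_measure U \<theta> x) \<in> borel_measurable (restrict_space borel S)"
proof -
  note D = Meas_cmpD[OF \<theta> V]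
  interpret finite_measure \<theta> using D(2,3) by (intro finite_measureI) auto
  have fm[measurable]: "f \<in> borel_measurable (restrict_space borel U)"
    using f by (rule borel_measurable_continuous_on_restrict)
  have "(\<lambda>p. fst p + snd p) \<in> restrict_space borel S \<Otimes>\<^sub>M \<theta> \<rightarrow>\<^sub>M restrict_space borel U"
  proof (rule measurable_restrict_space2)
    show "(\<lambda>p. fst p + snd p) \<in> space (restrict_space borel S \<Otimes>\<^sub>M \<theta>) \<rightarrow> U"
      using sub by (auto simp: space_pair_measure space_restrict_space D(2))
    have [measurable]: "(\<lambda>x. x) \<in> restrict_space borel S \<rightarrow>\<^sub>M borel"
      by (rule measurable_restrict_space1) simp
    have [measurable]: "(\<lambda>x. x) \<in> \<theta> \<rightarrow>\<^sub>M borel"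
      by (simp add: measurable_cong_sets[OF D(1) refl] measurable_restrict_space1)
    show "(\<lambda>p. fst p + snd p) \<in> restrict_space borel S \<Otimes>\<^sub>M \<theta> \<rightarrow>\<^sub>M borel"
      by measurable
  qed
  from measurable_compose[OF this fm]
  have "(\<lambda>x. \<integral>y. f (x + y) \<partial>\<theta>) \<in> borel_measurable (restrict_space borel S)"
    by (intro borel_measurable_lebesgue_integral) (simp add: split_beta')
  then show ?thesis
  proof (rule measurable_cong[THEN iffD1, rotated])
    fix x assume "x \<in> space (restrict_space borel S)"
    then have x: "x \<in> S" by (simp add: space_restrict_space)
    show "(\<integral>y. f (x + y) \<partial>\<theta>) = (\<integral>y. f y \<partial>translate_measure U \<theta> x)"
      unfolding translate_measure_def
      by (rule integral_distr[OF translate_measurable[OF U V \<theta> sub[OF x]] fm, symmetric])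
  qed
qed

lemma convolve_eq_integral_of_translates:
  fixes U V S :: "'a::euclidean_space set"
  assumes U: "open U" and V: "open V" and \<theta>: "\<theta> \<in> Meas_cmp V"
    and sub: "\<And>x y. x \<in> S \<Longrightarrow> y \<in> V \<Longrightarrow> x + y \<in> U"
    and \<mu>: "sets \<mu> = sets (restrict_space borel U)"
  shows "convolve_measures S \<mu> \<theta> = integral_of_measures S (translate_measure U \<theta>) \<mu>"
proof -
  have "(\<integral>\<^sup>+x\<in>S. emeasure \<theta> {y \<in> space \<theta>. x + y \<in> B} \<partial>\<mu>)
      = (\<integral>\<^sup>+x\<in>S. emeasure (translate_measure U \<theta> x) B \<partial>\<mu>)" if "B \<in> sets \<mu>" for B
    using that \<mu> by (intro nn_integral_cong)
      (auto simp: emeasure_translate_measure[OF U V \<theta> sub] split: split_indicator)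
  then show ?thesis
    unfolding convolve_measures_def integral_of_measures_def
    by (intro measure_of_eq) (auto simp: sets.sigma_sets_eq sets.space_closed dest: sets.sets_into_space)
qed

text \<open>
  The family of translates satisfies the hypotheses for integrals of measures: the translate by \<open>x\<close>
  lives on \<open>ball x r\<close>, and all translates have the same mass as \<open>\<theta>\<close>.
\<close>

lemma balayage_convolve_measures:
  fixes U S :: "'a::euclidean_space set"
  assumes U: "open U" and S: "S \<in> sets borel" "S \<subseteq> U"
    and \<mu>: "\<mu> \<in> Meas_cmp U" "measure_support \<mu> \<subseteq> S"
    and r: "r > 0" and L: "compact (closure (\<Union>x\<in>S. ball x r))" "closure (\<Union>x\<in>S. ball x r) \<subseteq> U"
    and \<theta>: "\<theta> \<in> Meas_cmp (ball 0 r)"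
  shows "convolve_measures S \<mu> \<theta> \<in> Meas_cmp U"
    and "\<lbrakk>H \<subseteq> usc U; \<And>h x. h \<in> H \<Longrightarrow> x \<in> S \<Longrightarrow> (\<lambda>y. h (x + y)) \<in> H';
        balayage H' (dirac (ball 0 r) 0) \<theta>\<rbrakk> \<Longrightarrow> balayage H \<mu> (convolve_measures S \<mu> \<theta>)"
proof -
  let ?\<theta> = "translate_measure U \<theta>"
  have img: "(\<lambda>y. x + y) ` ball 0 r = ball x r" for x :: 'a
    using ball_translation[of x 0 r] by simp
  have sub: "x + y \<in> U" if "x \<in> S" "y \<in> ball 0 r" for x y
    using that img[of x] closure_subset[of "\<Union>x\<in>S. ball x r"] L(2) by blast
  note T = translate_measure_Meas_cmp[OF U open_ball \<theta> sub]
  have "(\<Union>x\<in>S. measure_support (?\<theta> x)) \<subseteq> (\<Union>x\<in>S. ball x r)"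
    using T(2) unfolding img by blast
  then have cl: "closure (\<Union>x\<in>S. measure_support (?\<theta> x)) \<subseteq> closure (\<Union>x\<in>S. ball x r)"
    by (rule closure_mono)
  then have L': "compact (closure (\<Union>x\<in>S. measure_support (?\<theta> x)))"
      "closure (\<Union>x\<in>S. measure_support (?\<theta> x)) \<subseteq> U"
    using L by (auto simp: compact_eq_bounded_closed intro: bounded_subset)
  have "(SUP x\<in>S. emeasure (?\<theta> x) U) \<le> emeasure \<theta> (ball 0 r)"
    using emeasure_translate_measure_space[OF U open_ball \<theta> sub] by (intro SUP_least) simp
  also have "\<dots> < \<infinity>" by (rule Meas_cmpD(3)[OF \<theta> open_ball])
  finally have bdd: "(SUP x\<in>S. emeasure (?\<theta> x) U) < \<infinity>" .
  have C0: "(\<lambda>x. \<integral>y. f y \<partial>?\<theta> x) \<in> borel_measurable (restrict_space borel S)" if "f \<in> C0 U" for f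
    using that by (intro integral_translate_measure_measurable[OF U open_ball \<theta> sub]) (auto simp: C0_def)
  have eq: "convolve_measures S \<mu> \<theta> = integral_of_measures S ?\<theta> \<mu>"
    using sub by (rule convolve_eq_integral_of_translates[OF U open_ball \<theta> _ Meas_cmpD(1)[OF \<mu>(1) U]])
  show "convolve_measures S \<mu> \<theta> \<in> Meas_cmp U"
    unfolding eq by (intro balayage_integral_of_measures(1)[OF U S \<mu> _ L' bdd] T(1) C0)
  assume H: "H \<subseteq> usc U" "\<And>h x. h \<in> H \<Longrightarrow> x \<in> S \<Longrightarrow> (\<lambda>y. h (x + y)) \<in> H'"
    and bal: "balayage H' (dirac (ball 0 r) 0) \<theta>"
  have "balayage H (dirac U x) (?\<theta> x)" if x: "x \<in> S" for x
    by (rule balayage_translate_measure[OF U open_ball \<theta> sub[OF x] _ _ H(1) H(2)[OF _ x] bal])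
      (use x S r in auto)
  then show "balayage H \<mu> (convolve_measures S \<mu> \<theta>)"
    unfolding eq
    by (intro balayage_integral_of_measures(2)[OF U S \<mu> _ L' bdd _ H(1)] T(1) C0)
qed


section \<open>Balayage of a measure\<close>

theorem theorem2:
  fixes U S :: "(real ^ 'd) set" and \<mu> :: "(real ^ 'd) measure"
  assumes "open U" and "U \<noteq> {}"
    and "S \<in> sets borel" and "S \<subseteq> U" and "compact (closure S)" and "closure S \<subseteq> U"
    and "\<mu> \<in> Meas_cmp U" and "measure_support \<mu> \<subseteq> S"
  shows
    "(\<forall>\<theta> :: real ^ 'd \<Rightarrow> (real ^ 'd) measure.
        (\<forall>x\<in>S. \<theta> x \<in> Meas_cmp U) \<longrightarrow>
        compact (closure (\<Union>x\<in>S. measure_support (\<theta> x))) \<longrightarrow>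
        closure (\<Union>x\<in>S. measure_support (\<theta> x)) \<subseteq> U \<longrightarrow>
        (SUP x\<in>S. emeasure (\<theta> x) U) < \<infinity> \<longrightarrow>
        (\<forall>f\<in>C0 U. (\<lambda>x. \<integral>y. f y \<partial>(\<theta> x)) \<in> borel_measurable (restrict_space borel S)) \<longrightarrow>
          integral_of_measures S \<theta> \<mu> \<in> Meas_cmp U \<and>
          (\<forall>H. H \<noteq> {} \<longrightarrow> H \<subseteq> usc U \<longrightarrow> (\<forall>x\<in>S. balayage H (dirac U x) (\<theta> x)) \<longrightarrow>
             balayage H \<mu> (integral_of_measures S \<theta> \<mu>)))
     \<and>
     (\<forall>(r :: real) (\<theta> :: (real ^ 'd) measure).
        r > 0 \<longrightarrow>
        compact (closure (\<Union>x\<in>S. ball x r)) \<longrightarrow>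
        closure (\<Union>x\<in>S. ball x r) \<subseteq> U \<longrightarrow>
        \<theta> \<in> Meas_cmp (ball 0 r) \<longrightarrow>
          convolve_measures S \<mu> \<theta> \<in> Meas_cmp U \<and>
          (Arens_Singer_measure (ball 0 r) 0 \<theta> \<longrightarrow> balayage (har U) \<mu> (convolve_measures S \<mu> \<theta>)) \<and>
          (Jensen_measure (ball 0 r) 0 \<theta> \<longrightarrow> balayage (sbh U) \<mu> (convolve_measures S \<mu> \<theta>)))"
proof (intro conjI allI impI)
  fix \<theta> :: "real ^ 'd \<Rightarrow> (real ^ 'd) measure"
  assume \<theta>: "\<forall>x\<in>S. \<theta> x \<in> Meas_cmp U"
    and L: "compact (closure (\<Union>x\<in>S. measure_support (\<theta> x)))"
      "closure (\<Union>x\<in>S. measure_support (\<theta> x)) \<subseteq> U"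
    and bdd: "(SUP x\<in>S. emeasure (\<theta> x) U) < \<infinity>"
    and C0: "\<forall>f\<in>C0 U. (\<lambda>x. \<integral>y. f y \<partial>(\<theta> x)) \<in> borel_measurable (restrict_space borel S)"
  note main = balayage_integral_of_measures[OF assms(1,3,4,7,8) bspec[OF \<theta>] L bdd bspec[OF C0]]
  show "integral_of_measures S \<theta> \<mu> \<in> Meas_cmp U"
    by (rule main(1))
  show "balayage H \<mu> (integral_of_measures S \<theta> \<mu>)"
    if "H \<subseteq> usc U" "\<forall>x\<in>S. balayage H (dirac U x) (\<theta> x)" for H
    using that by (intro main(2)) auto
next
  fix r :: real and \<theta> :: "(real ^ 'd) measure"
  assume r: "r > 0" and L: "compact (closure (\<Union>x\<in>S. ball x r))" "closure (\<Union>x\<in>S. ball x r) \<subseteq> U"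
    and \<theta>: "\<theta> \<in> Meas_cmp (ball 0 r)"
  note main = balayage_convolve_measures[OF assms(1,3,4,7,8) r L \<theta>]
  have sub: "x + y \<in> U" if "x \<in> S" "y \<in> ball 0 r" for x y
  proof -
    have "x + y \<in> ball x r" using that by (simp add: dist_norm)
    then show ?thesis using that(1) closure_subset[of "\<Union>x\<in>S. ball x r"] L(2) by blast
  qed
  show "convolve_measures S \<mu> \<theta> \<in> Meas_cmp U"
    by (rule main(1))
  show "balayage (har U) \<mu> (convolve_measures S \<mu> \<theta>)" if "Arens_Singer_measure (ball 0 r) 0 \<theta>"
  proof (rule main(2)[OF har_subset_usc])
    show "(\<lambda>y. h (x + y)) \<in> har (ball 0 r)" if "h \<in> har U" "x \<in> S" for h x
      using that sub by (intro har_translate)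
  qed (use that in \<open>simp add: Arens_Singer_measure_def\<close>)
  show "balayage (sbh U) \<mu> (convolve_measures S \<mu> \<theta>)" if "Jensen_measure (ball 0 r) 0 \<theta>"
  proof (rule main(2))
    show "sbh U \<subseteq> usc U" by (auto simp: sbh_def)
    show "(\<lambda>y. h (x + y)) \<in> sbh (ball 0 r)" if "h \<in> sbh U" "x \<in> S" for h x
      using that sub by (intro sbh_translate)
  qed (use that in \<open>simp add: Jensen_measure_def\<close>)
qed

end
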